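(* Let $(\boldsymbol{X},\boldsymbol{T})$ be a nonautonomous dynamical system, $Z\subset X_0$, and let $\boldsymbol{d}=\{d_k\}_{k=0}^\infty$ and $\boldsymbol{d}'=\{d_k'\}_{k=0}^\infty$ be two sequences of metrics such that, for each $k\in\mathbb{N}$, $d_k$ and $d_k'$ induce the same topology on $X_k$. If $\boldsymbol{d}$ and $\boldsymbol{d}'$ are uniformly equivalent, then for all equicontinuous $\boldsymbol{f}\in\boldsymbol{C}(\boldsymbol{X},\mathbb{R})$, $$P_{\boldsymbol{d}}(\boldsymbol{T},\boldsymbol{f},Z)=P_{\boldsymbol{d}'}(\boldsymbol{T},\boldsymbol{f},Z)$$ for every $P\in\{P^{\mathrm{B}},P^{\mathrm{P}},P^{\mathrm{L}},P^{\mathrm{U}}\}$. In particular, $$h_{\boldsymbol{d}}(\boldsymbol{T},Z)=h_{\boldsymbol{d}'}(\boldsymbol{T},Z)$$ for $h\in\{h^{\mathrm{B}},h^{\mathrm{P}},\underline{h},\overline{h}\}$.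
   Context: A nonautonomous dynamical system (NDS) $(\boldsymbol{X},\boldsymbol{T})$ consists of a sequence $\boldsymbol{X}=\{X_k\}_{k=0}^\infty$ of compact metric spaces $(X_k,d_k)$ and a sequence $\boldsymbol{T}=\{T_k\}_{k=0}^\infty$ of continuous maps $T_k:X_k\to X_{k+1}$. Write $\boldsymbol{T}^0=\mathrm{id}_{X_0}$ and $\boldsymbol{T}^j=T_{j-1}\circ\cdots\circ T_0:X_0\to X_j$. For $n\ge 1$ the $n$-th Bowen metric on $X_0$ is $d_n^{\boldsymbol{T}}(x,y)=\max_{0\le j\le n-1}d_j(\boldsymbol{T}^jx,\boldsymbol{T}^jy)$; $B_n^{\boldsymbol{T}}(x,\varepsilon)$ and $\overline{B}_n^{\boldsymbol{T}}(x,\varepsilon)$ are the open ($<\varepsilon$) and closed ($\le\varepsilon$) balls of this metric. $\boldsymbol{C}(\boldsymbol{X},\mathbb{R})=\prod_{k\ge 0}C(X_k,\mathbb{R})$ is the set of sequences $\boldsymbol{f}=\{f_k\}_{k=0}^\infty$ of continuous functions $f_k:X_k\to\mathbb{R}$, $\boldsymbol{0}$ is the sequence of zero functions, and $S_n^{\boldsymbol{T}}\boldsymbol{f}=\sum_{j=0}^{n-1}f_j\circ\boldsymbol{T}^j$. $\boldsymbol{f}$ is equicontinuous if for every $\varepsilon>0$ there is $\delta>0$ such that for all $k\ge0$ and $x,y\in X_k$ with $d_k(x,y)<\delta$ we have $|f_k(x)-f_k(y)|<\varepsilon$ (for uniformly equivalent $\boldsymbol{d},\boldsymbol{d}'$ this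 does not depend on which is used). $\boldsymbol{d}$ and $\boldsymbol{d}'$ are uniformly equivalent if the identity maps $(X_k,d_k)\to(X_k,d_k')$, $k\ge0$, and the identity maps $(X_k,d_k')\to(X_k,d_k)$, $k\ge0$, are both equicontinuous sequences, i.e. for every $\varepsilon>0$ there is $\delta>0$ such that for all $k\ge0$ and $x,y\in X_k$: $d_k(x,y)<\delta\Rightarrow d_k'(x,y)<\varepsilon$, and $d_k'(x,y)<\delta\Rightarrow d_k(x,y)<\varepsilon$. The subscripts $\boldsymbol{d}$, $\boldsymbol{d}'$ indicate which metric sequence is used in defining the pressures and entropies below. Lower and upper pressures. For $Z\subset X_0$, $n\ge1$, $\varepsilon>0$: $F\subset X_0$ is $(n,\varepsilon)$-spanning for $Z$ if for every $x\in Z$ there is $y\in F$ with $d_n^{\boldsymbol{T}}(x,y)\le\varepsilon$; $E\subset Z$ is $(n,\varepsilon)$-separated for $Z$ if $d_n^{\boldsymbol{T}}(x,y)>\varepsilon$ for all distinct $x,y\in E$. Let $Q_n(\boldsymbol{T},\boldsymbol{f},Z,\varepsilon)=\inf_F\sum_{x\in F}e^{S_n^{\boldsymbol{T}}\boldsymbol{f}(x)}$ over $(n,\varepsilon)$-spanning sets $F$ for $Z$ and $P_n(\boldsymbol{T},\boldsymbol{f},Z,\varepsilon)=\sup_E\sum_{x\in E}e^{S_n^{\boldsymbol{T}}\boldsymbol{f}(x)}$ over $(n,\varepsilon)$-separated sets $E$ for $Z$. Let $\underline{Q}(\boldsymbol{T},\boldsymbol{f},Z,\varepsilon)$, $\overline{Q}(\boldsymbol{T},\boldsymbol{f},Z,\varepsilon)$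 be the $\liminf$, $\limsup$ as $n\to\infty$ of $\frac1n\log Q_n(\boldsymbol{T},\boldsymbol{f},Z,\varepsilon)$, and $\underline{P}(\boldsymbol{T},\boldsymbol{f},Z,\varepsilon)$, $\overline{P}(\boldsymbol{T},\boldsymbol{f},Z,\varepsilon)$ those of $\frac1n\log P_n(\boldsymbol{T},\boldsymbol{f},Z,\varepsilon)$ ($\log 0=-\infty$). Then $\underline{Q},\overline{Q},\underline{P},\overline{P}(\boldsymbol{T},\boldsymbol{f},Z)$ are the (monotone) limits of these as $\varepsilon\to0$. When $\underline{Q}=\underline{P}$ at $(\boldsymbol{T},\boldsymbol{f},Z)$ the common value is denoted $P^{\mathrm{L}}(\boldsymbol{T},\boldsymbol{f},Z)$; when $\overline{Q}=\overline{P}$ the common value is denoted $P^{\mathrm{U}}(\boldsymbol{T},\boldsymbol{f},Z)$. Both equalities hold whenever $\boldsymbol{f}$ is equicontinuous. Bowen pressure. For $s\in\mathbb{R}$, $N>0$, $\varepsilon>0$ let $\mathscr{R}^s_{N,\varepsilon}(\boldsymbol{T},\boldsymbol{f},Z)=\inf\sum_i\exp(-n_is+S_{n_i}^{\boldsymbol{T}}\boldsymbol{f}(x_i))$ over all countable families $\{B_{n_i}^{\boldsymbol{T}}(x_i,\varepsilon)\}_i$ with $n_i\ge N$, $x_i\in X_0$, covering $Z$. Put $\mathscr{R}^s_\varepsilon=\lim_{N\to\infty}\mathscr{R}^s_{N,\varepsilon}$, $P^{\mathrm{B}}(\boldsymbol{T},\boldsymbol{f},Z,\varepsilon)=\inf\{s:\mathscr{R}^s_\varepsilon(\boldsymbol{T},\boldsymbol{f},Z)=0\}=\sup\{s:\mathscr{R}^s_\varepsilon(\boldsymbol{T},\boldsymbol{f},Z)=+\infty\}$,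 and $P^{\mathrm{B}}(\boldsymbol{T},\boldsymbol{f},Z)=\lim_{\varepsilon\to0}P^{\mathrm{B}}(\boldsymbol{T},\boldsymbol{f},Z,\varepsilon)$. Packing pressure. Let $\mathscr{P}^s_{N,\varepsilon}(\boldsymbol{T},\boldsymbol{f},Z)=\sup\sum_i\exp(-n_is+S_{n_i}^{\boldsymbol{T}}\boldsymbol{f}(x_i))$ over all (at most) countable pairwise disjoint families $\{\overline{B}_{n_i}^{\boldsymbol{T}}(x_i,\varepsilon)\}_i$ with $x_i\in Z$, $n_i\ge N$. Put $\mathscr{P}^s_{\infty,\varepsilon}=\lim_{N\to\infty}\mathscr{P}^s_{N,\varepsilon}$, $\mathscr{P}^s_\varepsilon(\boldsymbol{T},\boldsymbol{f},Z)=\inf\{\sum_{i=1}^\infty\mathscr{P}^s_{\infty,\varepsilon}(\boldsymbol{T},\boldsymbol{f},Z_i):\bigcup_iZ_i\supset Z\}$, $P^{\mathrm{P}}(\boldsymbol{T},\boldsymbol{f},Z,\varepsilon)=\inf\{s:\mathscr{P}^s_\varepsilon(\boldsymbol{T},\boldsymbol{f},Z)=0\}=\sup\{s:\mathscr{P}^s_\varepsilon(\boldsymbol{T},\boldsymbol{f},Z)=+\infty\}$, and $P^{\mathrm{P}}(\boldsymbol{T},\boldsymbol{f},Z)=\lim_{\varepsilon\to0}P^{\mathrm{P}}(\boldsymbol{T},\boldsymbol{f},Z,\varepsilon)$. Entropies: $h^{\mathrm{B}}(\boldsymbol{T},Z)=P^{\mathrm{B}}(\boldsymbol{T},\boldsymbol{0},Z)$,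 $h^{\mathrm{P}}(\boldsymbol{T},Z)=P^{\mathrm{P}}(\boldsymbol{T},\boldsymbol{0},Z)$, $\underline{h}(\boldsymbol{T},Z)=P^{\mathrm{L}}(\boldsymbol{T},\boldsymbol{0},Z)$, $\overline{h}(\boldsymbol{T},Z)=P^{\mathrm{U}}(\boldsymbol{T},\boldsymbol{0},Z)$. All take values in $\mathbb{R}\cup\{\pm\infty\}$. *)

theory Defs
  imports "HOL-Analysis.Analysis"
begin

section \<open>Nonautonomous dynamical systems\<close>

text \<open>
  The spaces are carrier sets \<^term>\<open>X k\<close> in one common type; any sequence of spaces can be placed
  in such a type, for instance as a disjoint union.
\<close>

locale nds =
  fixes X :: "nat \<Rightarrow> 'a set" and d :: "nat \<Rightarrow> 'a \<Rightarrow> 'a \<Rightarrow> real" and T :: "nat \<Rightarrow> 'a \<Rightarrow> 'a"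
  assumes metric: "Metric_space (X k) (d k)"
    and compact: "compact_space (Metric_space.mtopology (X k) (d k))"
    and continuous: "continuous_map (Metric_space.mtopology (X k) (d k))
          (Metric_space.mtopology (X (Suc k)) (d (Suc k))) (T k)"

primrec iter :: "(nat \<Rightarrow> 'a \<Rightarrow> 'a) \<Rightarrow> nat \<Rightarrow> 'a \<Rightarrow> 'a" where
  "iter T 0 = id"
| "iter T (Suc j) = T j \<circ> iter T j"

definition bowen_metric ::
  "(nat \<Rightarrow> 'a \<Rightarrow> 'a \<Rightarrow> real) \<Rightarrow> (nat \<Rightarrow> 'a \<Rightarrow> 'a) \<Rightarrow> nat \<Rightarrow> 'a \<Rightarrow> 'a \<Rightarrow> real" where
  "bowen_metric d T n x y = Max ((\<lambda>j. d j (iter T j x) (iter T j y)) ` {..<n})"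

definition bowen_ball ::
  "(nat \<Rightarrow> 'a set) \<Rightarrow> (nat \<Rightarrow> 'a \<Rightarrow> 'a \<Rightarrow> real) \<Rightarrow> (nat \<Rightarrow> 'a \<Rightarrow> 'a) \<Rightarrow> nat \<Rightarrow> 'a \<Rightarrow> real \<Rightarrow> 'a set" where
  "bowen_ball X d T n x \<epsilon> = {y \<in> X 0. bowen_metric d T n x y < \<epsilon>}"

definition bowen_cball ::
  "(nat \<Rightarrow> 'a set) \<Rightarrow> (nat \<Rightarrow> 'a \<Rightarrow> 'a \<Rightarrow> real) \<Rightarrow> (nat \<Rightarrow> 'a \<Rightarrow> 'a) \<Rightarrow> nat \<Rightarrow> 'a \<Rightarrow> real \<Rightarrow> 'a set" where
  "bowen_cball X d T n x \<epsilon> = {y \<in> X 0. bowen_metric d T n x y \<le> \<epsilon>}"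

definition continuous_seq ::
  "(nat \<Rightarrow> 'a set) \<Rightarrow> (nat \<Rightarrow> 'a \<Rightarrow> 'a \<Rightarrow> real) \<Rightarrow> (nat \<Rightarrow> 'a \<Rightarrow> real) \<Rightarrow> bool" where
  "continuous_seq X d f \<longleftrightarrow>
     (\<forall>k. continuous_map (Metric_space.mtopology (X k) (d k)) euclideanreal (f k))"

definition equicontinuous_seq ::
  "(nat \<Rightarrow> 'a set) \<Rightarrow> (nat \<Rightarrow> 'a \<Rightarrow> 'a \<Rightarrow> real) \<Rightarrow> (nat \<Rightarrow> 'a \<Rightarrow> real) \<Rightarrow> bool" where
  "equicontinuous_seq X d f \<longleftrightarrow>
     (\<forall>\<epsilon>>0. \<exists>\<delta>>0. \<forall>k. \<forall>x\<in>X k. \<forall>y\<in>X k. d k x y < \<delta> \<longrightarrow> \<bar>f k x - f k y\<bar> < \<epsilon>)"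

definition uniformly_equivalent ::
  "(nat \<Rightarrow> 'a set) \<Rightarrow> (nat \<Rightarrow> 'a \<Rightarrow> 'a \<Rightarrow> real) \<Rightarrow> (nat \<Rightarrow> 'a \<Rightarrow> 'a \<Rightarrow> real) \<Rightarrow> bool" where
  "uniformly_equivalent X d d' \<longleftrightarrow>
     (\<forall>\<epsilon>>0. \<exists>\<delta>>0. \<forall>k. \<forall>x\<in>X k. \<forall>y\<in>X k.
        (d k x y < \<delta> \<longrightarrow> d' k x y < \<epsilon>) \<and> (d' k x y < \<delta> \<longrightarrow> d k x y < \<epsilon>))"

definition birkhoff ::
  "(nat \<Rightarrow> 'a \<Rightarrow> 'a) \<Rightarrow> (nat \<Rightarrow> 'a \<Rightarrow> real) \<Rightarrow> nat \<Rightarrow> 'a \<Rightarrow> real" where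
  "birkhoff T f n x = (\<Sum>j<n. f j (iter T j x))"

section \<open>Lower and upper pressures\<close>

definition spanning ::
  "(nat \<Rightarrow> 'a set) \<Rightarrow> (nat \<Rightarrow> 'a \<Rightarrow> 'a \<Rightarrow> real) \<Rightarrow> (nat \<Rightarrow> 'a \<Rightarrow> 'a) \<Rightarrow> 'a set \<Rightarrow> nat \<Rightarrow> real \<Rightarrow> 'a set \<Rightarrow> bool" where
  "spanning X d T Z n \<epsilon> F \<longleftrightarrow> F \<subseteq> X 0 \<and> (\<forall>x\<in>Z. \<exists>y\<in>F. bowen_metric d T n x y \<le> \<epsilon>)"

definition separated ::
  "(nat \<Rightarrow> 'a \<Rightarrow> 'a \<Rightarrow> real) \<Rightarrow> (nat \<Rightarrow> 'a \<Rightarrow> 'a) \<Rightarrow> 'a set \<Rightarrow> nat \<Rightarrow> real \<Rightarrow> 'a set \<Rightarrow> bool" where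
  "separated d T Z n \<epsilon> E \<longleftrightarrow>
     E \<subseteq> Z \<and> (\<forall>x\<in>E. \<forall>y\<in>E. x \<noteq> y \<longrightarrow> bowen_metric d T n x y > \<epsilon>)"

text \<open>
  Sums over arbitrary sets are unordered sums in \<^typ>\<open>ennreal\<close>; they always exist and are the
  suprema of the finite partial sums.
\<close>

definition span_sum ::
  "(nat \<Rightarrow> 'a set) \<Rightarrow> (nat \<Rightarrow> 'a \<Rightarrow> 'a \<Rightarrow> real) \<Rightarrow> (nat \<Rightarrow> 'a \<Rightarrow> 'a) \<Rightarrow> (nat \<Rightarrow> 'a \<Rightarrow> real) \<Rightarrow> 'a set
     \<Rightarrow> real \<Rightarrow> nat \<Rightarrow> ennreal" where
  "span_sum X d T f Z \<epsilon> n =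
     (INF F\<in>{F. spanning X d T Z n \<epsilon> F}. \<Sum>\<^sub>\<infinity>x\<in>F. ennreal (exp (birkhoff T f n x)))"

definition sep_sum ::
  "(nat \<Rightarrow> 'a \<Rightarrow> 'a \<Rightarrow> real) \<Rightarrow> (nat \<Rightarrow> 'a \<Rightarrow> 'a) \<Rightarrow> (nat \<Rightarrow> 'a \<Rightarrow> real) \<Rightarrow> 'a set
     \<Rightarrow> real \<Rightarrow> nat \<Rightarrow> ennreal" where
  "sep_sum d T f Z \<epsilon> n =
     (SUP E\<in>{E. separated d T Z n \<epsilon> E}. \<Sum>\<^sub>\<infinity>x\<in>E. ennreal (exp (birkhoff T f n x)))"

definition elog :: "ennreal \<Rightarrow> ereal" where
  "elog x = (if x = 0 then -\<infinity> else if x = \<infinity> then \<infinity> else ereal (ln (enn2real x)))"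

definition lower_span_at where
  "lower_span_at X d T f Z \<epsilon> = liminf (\<lambda>n. ereal (1 / real n) * elog (span_sum X d T f Z \<epsilon> n))"

definition upper_span_at where
  "upper_span_at X d T f Z \<epsilon> = limsup (\<lambda>n. ereal (1 / real n) * elog (span_sum X d T f Z \<epsilon> n))"

definition lower_sep_at where
  "lower_sep_at d T f Z \<epsilon> = liminf (\<lambda>n. ereal (1 / real n) * elog (sep_sum d T f Z \<epsilon> n))"

definition upper_sep_at where
  "upper_sep_at d T f Z \<epsilon> = limsup (\<lambda>n. ereal (1 / real n) * elog (sep_sum d T f Z \<epsilon> n))"

definition lower_span where
  "lower_span X d T f Z = Lim (at_right 0) (lower_span_at X d T f Z)"

definition upper_span where
  "upper_span X d T f Z = Lim (at_right 0) (upper_span_at X d T f Z)"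

definition lower_sep where
  "lower_sep d T f Z = Lim (at_right 0) (lower_sep_at d T f Z)"

definition upper_sep where
  "upper_sep d T f Z = Lim (at_right 0) (upper_sep_at d T f Z)"

text \<open>
  The lower and upper pressures are the common values of the spanning and separated versions. For
  equicontinuous \<^term>\<open>f\<close> these common values exist: see \<open>lower_pressure_eq\<close> and
  \<open>upper_pressure_eq\<close> below.
\<close>

definition lower_pressure ::
  "(nat \<Rightarrow> 'a set) \<Rightarrow> (nat \<Rightarrow> 'a \<Rightarrow> 'a \<Rightarrow> real) \<Rightarrow> (nat \<Rightarrow> 'a \<Rightarrow> 'a) \<Rightarrow> (nat \<Rightarrow> 'a \<Rightarrow> real) \<Rightarrow> 'a set
     \<Rightarrow> ereal" where
  "lower_pressure X d T f Z = (THE p. lower_span X d T f Z = p \<and> lower_sep d T f Z = p)"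

definition upper_pressure ::
  "(nat \<Rightarrow> 'a set) \<Rightarrow> (nat \<Rightarrow> 'a \<Rightarrow> 'a \<Rightarrow> real) \<Rightarrow> (nat \<Rightarrow> 'a \<Rightarrow> 'a) \<Rightarrow> (nat \<Rightarrow> 'a \<Rightarrow> real) \<Rightarrow> 'a set
     \<Rightarrow> ereal" where
  "upper_pressure X d T f Z = (THE p. upper_span X d T f Z = p \<and> upper_sep d T f Z = p)"

section \<open>Bowen pressure\<close>

text \<open>
  At most countable families, here and for the packing pressure, are indexed by arbitrary subsets
  \<^term>\<open>I :: nat set\<close> of the natural numbers.
\<close>

definition bowen_cover ::
  "(nat \<Rightarrow> 'a set) \<Rightarrow> (nat \<Rightarrow> 'a \<Rightarrow> 'a \<Rightarrow> real) \<Rightarrow> (nat \<Rightarrow> 'a \<Rightarrow> 'a) \<Rightarrow> 'a set \<Rightarrow> real \<Rightarrow> nat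
     \<Rightarrow> nat set \<Rightarrow> (nat \<Rightarrow> nat) \<Rightarrow> (nat \<Rightarrow> 'a) \<Rightarrow> bool" where
  "bowen_cover X d T Z \<epsilon> N I m x \<longleftrightarrow>
     (\<forall>i\<in>I. m i \<ge> N \<and> x i \<in> X 0) \<and> Z \<subseteq> (\<Union>i\<in>I. bowen_ball X d T (m i) (x i) \<epsilon>)"

definition bowen_outer_N ::
  "(nat \<Rightarrow> 'a set) \<Rightarrow> (nat \<Rightarrow> 'a \<Rightarrow> 'a \<Rightarrow> real) \<Rightarrow> (nat \<Rightarrow> 'a \<Rightarrow> 'a) \<Rightarrow> (nat \<Rightarrow> 'a \<Rightarrow> real) \<Rightarrow> 'a set
     \<Rightarrow> real \<Rightarrow> real \<Rightarrow> nat \<Rightarrow> ennreal" where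
  "bowen_outer_N X d T f Z \<epsilon> s N =
     (INF (I, m, x)\<in>{(I, m, x). bowen_cover X d T Z \<epsilon> N I m x}.
        \<Sum>\<^sub>\<infinity>i\<in>I. ennreal (exp (- real (m i) * s + birkhoff T f (m i) (x i))))"

definition bowen_outer where
  "bowen_outer X d T f Z \<epsilon> s = lim (bowen_outer_N X d T f Z \<epsilon> s)"

definition bowen_pressure_at where
  "bowen_pressure_at X d T f Z \<epsilon> = (INF s\<in>{s. bowen_outer X d T f Z \<epsilon> s = 0}. ereal s)"

definition bowen_pressure where
  "bowen_pressure X d T f Z = Lim (at_right 0) (bowen_pressure_at X d T f Z)"

section \<open>Packing pressure\<close>

definition bowen_packing ::
  "(nat \<Rightarrow> 'a set) \<Rightarrow> (nat \<Rightarrow> 'a \<Rightarrow> 'a \<Rightarrow> real) \<Rightarrow> (nat \<Rightarrow> 'a \<Rightarrow> 'a) \<Rightarrow> 'a set \<Rightarrow> real \<Rightarrow> nat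
     \<Rightarrow> nat set \<Rightarrow> (nat \<Rightarrow> nat) \<Rightarrow> (nat \<Rightarrow> 'a) \<Rightarrow> bool" where
  "bowen_packing X d T Z \<epsilon> N I m x \<longleftrightarrow>
     (\<forall>i\<in>I. m i \<ge> N \<and> x i \<in> Z) \<and> disjoint_family_on (\<lambda>i. bowen_cball X d T (m i) (x i) \<epsilon>) I"

definition packing_pre_N ::
  "(nat \<Rightarrow> 'a set) \<Rightarrow> (nat \<Rightarrow> 'a \<Rightarrow> 'a \<Rightarrow> real) \<Rightarrow> (nat \<Rightarrow> 'a \<Rightarrow> 'a) \<Rightarrow> (nat \<Rightarrow> 'a \<Rightarrow> real) \<Rightarrow> 'a set
     \<Rightarrow> real \<Rightarrow> real \<Rightarrow> nat \<Rightarrow> ennreal" where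
  "packing_pre_N X d T f Z \<epsilon> s N =
     (SUP (I, m, x)\<in>{(I, m, x). bowen_packing X d T Z \<epsilon> N I m x}.
        \<Sum>\<^sub>\<infinity>i\<in>I. ennreal (exp (- real (m i) * s + birkhoff T f (m i) (x i))))"

definition packing_pre where
  "packing_pre X d T f Z \<epsilon> s = lim (packing_pre_N X d T f Z \<epsilon> s)"

definition packing_outer where
  "packing_outer X d T f Z \<epsilon> s =
     (INF A\<in>{A :: nat \<Rightarrow> 'a set. (\<forall>i. A i \<subseteq> X 0) \<and> Z \<subseteq> (\<Union>i. A i)}.
        \<Sum>i. packing_pre X d T f (A i) \<epsilon> s)"

definition packing_pressure_at where
  "packing_pressure_at X d T f Z \<epsilon> = (INF s\<in>{s. packing_outer X d T f Z \<epsilon> s = 0}. ereal s)"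

definition packing_pressure where
  "packing_pressure X d T f Z = Lim (at_right 0) (packing_pressure_at X d T f Z)"

section \<open>Entropies\<close>

definition bowen_entropy where
  "bowen_entropy X d T Z = bowen_pressure X d T (\<lambda>_ _. 0) Z"

definition packing_entropy where
  "packing_entropy X d T Z = packing_pressure X d T (\<lambda>_ _. 0) Z"

definition lower_entropy where
  "lower_entropy X d T Z = lower_pressure X d T (\<lambda>_ _. 0) Z"

definition upper_entropy where
  "upper_entropy X d T Z = upper_pressure X d T (\<lambda>_ _. 0) Z"

section \<open>Well-definedness\<close>

lemma antimono_tendsto_at_right:
  fixes g :: "real \<Rightarrow> ereal"
  assumes mono: "\<And>a b. 0 < a \<Longrightarrow> a \<le> b \<Longrightarrow> g b \<le> g a"
  shows "(g \<longlongrightarrow> (SUP \<epsilon>\<in>{0<..}. g \<epsilon>)) (at_right 0)"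
proof (rule order_tendstoI)
  fix a assume "a < (SUP \<epsilon>\<in>{0<..}. g \<epsilon>)"
  then obtain e where e: "e > 0" "a < g e" by (auto simp: less_SUP_iff)
  then have "a < g x" if "0 < x" "x < e" for x using mono[of x e] that by auto
  then show "eventually (\<lambda>x. a < g x) (at_right 0)"
    unfolding eventually_at_right_field using e by blast
next
  fix a assume a: "(SUP \<epsilon>\<in>{0<..}. g \<epsilon>) < a"
  have "g x < a" if "x > 0" for x
    using that by (intro le_less_trans[OF SUP_upper a]) auto
  then show "eventually (\<lambda>x. g x < a) (at_right 0)"
    unfolding eventually_at_right_field by (intro exI[of _ 1]) auto
qed

lemma Lim_at_right_antimono:
  fixes g :: "real \<Rightarrow> ereal"
  assumes "\<And>a b. 0 < a \<Longrightarrow> a \<le> b \<Longrightarrow> g b \<le> g a"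
  shows "Lim (at_right 0) g = (SUP \<epsilon>\<in>{0<..}. g \<epsilon>)"
  by (intro tendsto_Lim antimono_tendsto_at_right assms) auto

lemma elog_mono: "x \<le> y \<Longrightarrow> elog x \<le> elog y"
  unfolding elog_def
  by (cases x; cases y) (auto simp: ennreal_le_iff2 top_unique less_imp_le)

lemma elog_exp_mult: "elog (ennreal (exp a) * x) = ereal a + elog x"
  by (cases x) (auto simp: elog_def ennreal_mult_top ennreal_mult[symmetric] ln_mult)

lemma span_sum_antimono: "a \<le> b \<Longrightarrow> span_sum X d T f Z b n \<le> span_sum X d T f Z a n"
  unfolding span_sum_def by (intro INF_superset_mono) (auto simp: spanning_def, meson order_trans)

lemma sep_sum_antimono: "a \<le> b \<Longrightarrow> sep_sum d T f Z b n \<le> sep_sum d T f Z a n"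
  unfolding sep_sum_def by (intro SUP_subset_mono) (auto simp: separated_def, meson le_less_trans)

lemma lower_span_at_antimono: "a \<le> b \<Longrightarrow> lower_span_at X d T f Z b \<le> lower_span_at X d T f Z a"
  unfolding lower_span_at_def
  by (intro Liminf_mono always_eventually allI ereal_mult_left_mono elog_mono span_sum_antimono) auto

lemma upper_span_at_antimono: "a \<le> b \<Longrightarrow> upper_span_at X d T f Z b \<le> upper_span_at X d T f Z a"
  unfolding upper_span_at_def
  by (intro Limsup_mono always_eventually allI ereal_mult_left_mono elog_mono span_sum_antimono) auto

lemma lower_sep_at_antimono: "a \<le> b \<Longrightarrow> lower_sep_at d T f Z b \<le> lower_sep_at d T f Z a"
  unfolding lower_sep_at_def
  by (intro Liminf_mono always_eventually allI ereal_mult_left_mono elog_mono sep_sum_antimono) auto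

lemma upper_sep_at_antimono: "a \<le> b \<Longrightarrow> upper_sep_at d T f Z b \<le> upper_sep_at d T f Z a"
  unfolding upper_sep_at_def
  by (intro Limsup_mono always_eventually allI ereal_mult_left_mono elog_mono sep_sum_antimono) auto

lemma bowen_outer_N_mono: "incseq (bowen_outer_N X d T f Z \<epsilon> s)"
  unfolding incseq_def bowen_outer_N_def
  by (intro allI impI INF_superset_mono) (fastforce simp: bowen_cover_def)+

lemma bowen_outer_N_tendsto:
  "bowen_outer_N X d T f Z \<epsilon> s \<longlonglongrightarrow> bowen_outer X d T f Z \<epsilon> s"
  unfolding bowen_outer_def
  using LIMSEQ_SUP[OF bowen_outer_N_mono] by (metis limI)

lemma packing_pre_N_antimono: "decseq (packing_pre_N X d T f Z \<epsilon> s)"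
  unfolding decseq_def packing_pre_N_def
  by (intro allI impI SUP_subset_mono) (fastforce simp: bowen_packing_def)+

lemma packing_pre_N_tendsto:
  "packing_pre_N X d T f Z \<epsilon> s \<longlonglongrightarrow> packing_pre X d T f Z \<epsilon> s"
  unfolding packing_pre_def
  using LIMSEQ_INF[OF packing_pre_N_antimono] by (metis limI)

lemma bowen_pressure_at_antimono:
  assumes "a \<le> b"
  shows "bowen_pressure_at X d T f Z b \<le> bowen_pressure_at X d T f Z a"
proof -
  have "bowen_outer_N X d T f Z b s N \<le> bowen_outer_N X d T f Z a s N" for s N
    unfolding bowen_outer_N_def using assms
    by (intro INF_superset_mono) (auto simp: bowen_cover_def bowen_ball_def subset_eq, meson less_le_trans)
  then have "bowen_outer X d T f Z b s \<le> bowen_outer X d T f Z a s" for s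
    by (intro LIMSEQ_le[OF bowen_outer_N_tendsto bowen_outer_N_tendsto]) auto
  then show ?thesis
    unfolding bowen_pressure_at_def by (intro INF_superset_mono) (auto simp: le_zero_eq[symmetric] simp del: le_zero_eq intro: order_trans)
qed

lemma packing_pressure_at_antimono:
  assumes "a \<le> b"
  shows "packing_pressure_at X d T f Z b \<le> packing_pressure_at X d T f Z a"
proof -
  have "packing_pre_N X d T f A b s N \<le> packing_pre_N X d T f A a s N" for A s N
    unfolding packing_pre_N_def using assms
    by (intro SUP_subset_mono)
       (auto simp: bowen_packing_def bowen_cball_def disjoint_family_on_def disjoint_iff, meson order_trans)
  then have "packing_pre X d T f A b s \<le> packing_pre X d T f A a s" for A s
    by (intro LIMSEQ_le[OF packing_pre_N_tendsto packing_pre_N_tendsto]) auto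
  then have "packing_outer X d T f Z b s \<le> packing_outer X d T f Z a s" for s
    unfolding packing_outer_def by (intro INF_mono) (auto intro!: suminf_le)
  then show ?thesis
    unfolding packing_pressure_at_def by (intro INF_superset_mono) (auto simp: le_zero_eq[symmetric] simp del: le_zero_eq intro: order_trans)
qed

lemma pressures_tendsto:
  shows "(lower_span_at X d T f Z \<longlongrightarrow> lower_span X d T f Z) (at_right 0)"
    and "(upper_span_at X d T f Z \<longlongrightarrow> upper_span X d T f Z) (at_right 0)"
    and "(lower_sep_at d T f Z \<longlongrightarrow> lower_sep d T f Z) (at_right 0)"
    and "(upper_sep_at d T f Z \<longlongrightarrow> upper_sep d T f Z) (at_right 0)"
    and "(bowen_pressure_at X d T f Z \<longlongrightarrow> bowen_pressure X d T f Z) (at_right 0)"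
    and "(packing_pressure_at X d T f Z \<longlongrightarrow> packing_pressure X d T f Z) (at_right 0)"
  unfolding lower_span_def upper_span_def lower_sep_def upper_sep_def bowen_pressure_def
    packing_pressure_def
  by (subst Lim_at_right_antimono antimono_tendsto_at_right;
      simp add: antimono_tendsto_at_right lower_span_at_antimono upper_span_at_antimono
        lower_sep_at_antimono upper_sep_at_antimono bowen_pressure_at_antimono
        packing_pressure_at_antimono)+

context nds
begin

lemma iter_in: "x \<in> X 0 \<Longrightarrow> iter T j x \<in> X j"
proof (induction j)
  case (Suc j)
  interpret A: Metric_space "X j" "d j" by (rule metric)
  interpret B: Metric_space "X (Suc j)" "d (Suc j)" by (rule metric)
  show ?case using continuous_map_funspace[OF continuous[of j]] Suc by auto
qed auto

lemma bowen_metric_le_iff: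
  "n > 0 \<Longrightarrow> bowen_metric d T n x y \<le> e \<longleftrightarrow> (\<forall>j<n. d j (iter T j x) (iter T j y) \<le> e)"
  unfolding bowen_metric_def by (subst Max_le_iff) auto

lemma bowen_metric_refl: "n > 0 \<Longrightarrow> x \<in> X 0 \<Longrightarrow> e \<ge> 0 \<Longrightarrow> bowen_metric d T n x x \<le> e"
  using iter_in by (auto simp: bowen_metric_le_iff Metric_space.mdist_zero[OF metric])

lemma bowen_metric_commute: "bowen_metric d T n x y = bowen_metric d T n y x"
  unfolding bowen_metric_def by (subst Metric_space.commute[OF metric]) (rule refl)

lemma span_sum_le_sep_sum:
  assumes "n > 0" "\<epsilon> > 0" "Z \<subseteq> X 0"
  shows "span_sum X d T f Z \<epsilon> n \<le> sep_sum d T f Z \<epsilon> n"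
proof -
  have "\<exists>E\<in>{E. separated d T Z n \<epsilon> E}. \<forall>E'\<in>{E. separated d T Z n \<epsilon> E}. E \<subseteq> E' \<longrightarrow> E' = E"
  proof (rule subset_Zorn')
    fix C assume "subset.chain {E. separated d T Z n \<epsilon> E} C"
    then have C: "\<And>E. E \<in> C \<Longrightarrow> separated d T Z n \<epsilon> E" "\<And>A B. A \<in> C \<Longrightarrow> B \<in> C \<Longrightarrow> A \<subseteq> B \<or> B \<subseteq> A"
      by (auto simp: subset_chain_def)
    have "bowen_metric d T n x y > \<epsilon>" if "A \<in> C" "B \<in> C" "x \<in> A" "y \<in> B" "x \<noteq> y" for A B x y
    proof -
      from C(2)[OF that(1,2)] that(1-4) obtain E where "E \<in> C" "x \<in> E" "y \<in> E" by blast
      then show ?thesis using C(1)[of E] \<open>x \<noteq> y\<close> by (simp add: separated_def)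
    qed
    with C(1) show "\<Union>C \<in> {E. separated d T Z n \<epsilon> E}"
      by (auto simp: separated_def)
  qed
  then obtain E where E: "separated d T Z n \<epsilon> E"
    and max: "\<And>E'. separated d T Z n \<epsilon> E' \<Longrightarrow> E \<subseteq> E' \<Longrightarrow> E' = E" by auto
  have "\<exists>y\<in>E. bowen_metric d T n x y \<le> \<epsilon>" if x: "x \<in> Z" for x
  proof (rule ccontr)
    assume neg: "\<not> ?thesis"
    then have "bowen_metric d T n x y > \<epsilon>" "bowen_metric d T n y x > \<epsilon>" if "y \<in> E" for y
      using that bowen_metric_commute[of n x y] by (auto simp: not_le)
    then have "separated d T Z n \<epsilon> (insert x E)"
      using E x by (simp add: separated_def)
    then have "x \<in> E" using max[of "insert x E"] by auto
    then show False using neg x assms bowen_metric_refl[of n x \<epsilon>] by auto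
  qed
  then have "spanning X d T Z n \<epsilon> E"
    using E assms by (auto simp: spanning_def separated_def)
  then have "span_sum X d T f Z \<epsilon> n \<le> (\<Sum>\<^sub>\<infinity>x\<in>E. ennreal (exp (birkhoff T f n x)))"
    unfolding span_sum_def by (intro INF_lower) auto
  also have "\<dots> \<le> sep_sum d T f Z \<epsilon> n"
    unfolding sep_sum_def using E by (intro SUP_upper) auto
  finally show ?thesis .
qed

lemma sep_sum_le_span_sum:
  assumes "n > 0" "Z \<subseteq> X 0"
    and f: "\<And>k x y. x \<in> X k \<Longrightarrow> y \<in> X k \<Longrightarrow> d k x y \<le> \<epsilon> \<Longrightarrow> \<bar>f k x - f k y\<bar> \<le> \<eta>"
  shows "sep_sum d T f Z (2 * \<epsilon>) n \<le> ennreal (exp (real n * \<eta>)) * span_sum X d T f Z \<epsilon> n"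
proof -
  let ?w = "\<lambda>x. ennreal (exp (birkhoff T f n x))"
  have main: "infsum ?w E \<le> ennreal (exp (real n * \<eta>)) * infsum ?w F"
    if E: "separated d T Z n (2 * \<epsilon>) E" and F: "spanning X d T Z n \<epsilon> F" for E F
  proof -
    obtain p where p: "\<And>x. x \<in> E \<Longrightarrow> p x \<in> F" "\<And>x. x \<in> E \<Longrightarrow> bowen_metric d T n x (p x) \<le> \<epsilon>"
      using E F unfolding separated_def spanning_def by (metis subsetD)
    have EX: "x \<in> X 0" if "x \<in> E" for x using that E assms by (auto simp: separated_def)
    have FX: "x \<in> X 0" if "x \<in> F" for x using that F by (auto simp: spanning_def)
    have dj: "d j (iter T j x) (iter T j (p x)) \<le> \<epsilon>" if "x \<in> E" "j < n" for x j
      using p(2)[OF that(1)] that(2) assms(1) by (simp add: bowen_metric_le_iff)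
    have inj: "inj_on p E"
    proof (rule inj_onI, rule ccontr)
      fix x y assume xy: "x \<in> E" "y \<in> E" "p x = p y" "x \<noteq> y"
      have "bowen_metric d T n x y \<le> 2 * \<epsilon>"
        unfolding bowen_metric_le_iff[OF assms(1)]
      proof (intro allI impI)
        fix j assume j: "j < n"
        interpret Metric_space "X j" "d j" by (rule metric)
        have "d j (iter T j x) (iter T j y)
            \<le> d j (iter T j x) (iter T j (p x)) + d j (iter T j y) (iter T j (p x))"
          using xy p(1) EX FX iter_in by (intro triangle') auto
        then show "d j (iter T j x) (iter T j y) \<le> 2 * \<epsilon>"
          using dj[OF xy(1) j] dj[OF xy(2) j] xy(3) by simp
      qed
      then show False using E xy unfolding separated_def by force
    qed
    have le: "?w x \<le> ennreal (exp (real n * \<eta>)) * ?w (p x)" if x: "x \<in> E" for x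
    proof -
      have "birkhoff T f n x - birkhoff T f n (p x) \<le> (\<Sum>j<n. \<eta>)"
        unfolding birkhoff_def sum_subtractf[symmetric]
      proof (rule sum_mono)
        fix j assume "j \<in> {..<n}"
        then show "f j (iter T j x) - f j (iter T j (p x)) \<le> \<eta>"
          using f[of "iter T j x" j "iter T j (p x)"] dj[OF x] iter_in EX[OF x] FX[OF p(1)[OF x]]
          by fastforce
      qed
      then have "exp (birkhoff T f n x) \<le> exp (real n * \<eta>) * exp (birkhoff T f n (p x))"
        by (simp add: exp_add[symmetric])
      then show ?thesis by (simp add: ennreal_mult[symmetric])
    qed
    have "infsum ?w E \<le> (\<Sum>\<^sub>\<infinity>x\<in>E. ennreal (exp (real n * \<eta>)) * ?w (p x))"
      by (intro infsum_mono nonneg_summable_on_complete le) auto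
    also have "\<dots> = (\<Sum>\<^sub>\<infinity>y\<in>p ` E. ennreal (exp (real n * \<eta>)) * ?w y)"
      using inj by (simp add: infsum_reindex o_def)
    also have "\<dots> \<le> (\<Sum>\<^sub>\<infinity>y\<in>F. ennreal (exp (real n * \<eta>)) * ?w y)"
      by (intro infsum_mono_neutral nonneg_summable_on_complete) (use p(1) in auto)
    also have "\<dots> = ennreal (exp (real n * \<eta>)) * infsum ?w F"
      unfolding nonneg_infsum_complete[OF zero_le] sum_distrib_left[symmetric]
      by (subst SUP_mult_left_ennreal) simp
    finally show ?thesis .
  qed
  have "sep_sum d T f Z (2 * \<epsilon>) n / ennreal (exp (real n * \<eta>)) \<le> span_sum X d T f Z \<epsilon> n"
    unfolding span_sum_def
  proof (rule INF_greatest)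
    fix F assume "F \<in> {F. spanning X d T Z n \<epsilon> F}"
    then have "sep_sum d T f Z (2 * \<epsilon>) n \<le> ennreal (exp (real n * \<eta>)) * infsum ?w F"
      unfolding sep_sum_def using main by (intro SUP_least) auto
    then show "sep_sum d T f Z (2 * \<epsilon>) n / ennreal (exp (real n * \<eta>)) \<le> infsum ?w F"
      by (intro divide_le_posI_ennreal) (auto simp: mult.commute)
  qed
  then have "ennreal (exp (real n * \<eta>)) * (sep_sum d T f Z (2 * \<epsilon>) n / ennreal (exp (real n * \<eta>)))
      \<le> ennreal (exp (real n * \<eta>)) * span_sum X d T f Z \<epsilon> n"
    by (rule mult_left_mono) simp
  then show ?thesis
    by (simp add: ennreal_times_divide mult.commute[of "ennreal (exp (real n * \<eta>))"]
        mult_divide_eq_ennreal)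
qed

lemma rate_le:
  assumes "equicontinuous_seq X d f" "Z \<subseteq> X 0" "\<eta> > 0"
  shows "\<exists>\<epsilon>>0. \<forall>e n. 0 < e \<and> e \<le> \<epsilon> \<and> n > 0 \<longrightarrow>
    ereal (1 / real n) * elog (sep_sum d T f Z (2 * e) n)
      \<le> ereal (1 / real n) * elog (span_sum X d T f Z e n) + ereal \<eta>"
proof -
  obtain \<delta> where \<delta>: "\<delta> > 0"
    "\<And>k x y. x \<in> X k \<Longrightarrow> y \<in> X k \<Longrightarrow> d k x y < \<delta> \<Longrightarrow> \<bar>f k x - f k y\<bar> < \<eta>"
    using assms(1,3) unfolding equicontinuous_seq_def by metis
  have "ereal (1 / real n) * elog (sep_sum d T f Z (2 * e) n)
      \<le> ereal (1 / real n) * elog (span_sum X d T f Z e n) + ereal \<eta>"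
    if e: "0 < e" "e \<le> \<delta> / 2" and n: "n > 0" for e n
  proof -
    have "elog (sep_sum d T f Z (2 * e) n) \<le> ereal (real n * \<eta>) + elog (span_sum X d T f Z e n)"
      using sep_sum_le_span_sum[OF n assms(2), of e f \<eta>] \<delta> e
      by (subst elog_exp_mult[symmetric]) (force intro: elog_mono less_imp_le)
    then have "ereal (1 / real n) * elog (sep_sum d T f Z (2 * e) n)
        \<le> ereal (1 / real n) * (ereal (real n * \<eta>) + elog (span_sum X d T f Z e n))"
      by (intro ereal_mult_left_mono) auto
    also have "\<dots> = ereal (1 / real n) * elog (span_sum X d T f Z e n) + ereal \<eta>"
      using n by (cases "elog (span_sum X d T f Z e n)") (auto simp: field_simps)
    finally show ?thesis .
  qed
  then show ?thesis using \<delta>(1) by (intro exI[of _ "\<delta> / 2"]) auto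
qed

lemma sup_eqI:
  fixes g h :: "real \<Rightarrow> ereal"
  assumes mono: "\<And>a b. 0 < a \<Longrightarrow> a \<le> b \<Longrightarrow> h b \<le> h a"
    and le: "\<And>e. e > 0 \<Longrightarrow> g e \<le> h e"
    and ge: "\<And>\<eta>. \<eta> > 0 \<Longrightarrow> \<exists>\<epsilon>>0. \<forall>e. 0 < e \<and> e \<le> \<epsilon> \<longrightarrow> h (2 * e) \<le> g e + ereal \<eta>"
  shows "(SUP \<epsilon>\<in>{0<..}. g \<epsilon>) = (SUP \<epsilon>\<in>{0<..}. h \<epsilon>)"
proof (rule antisym)
  show "(SUP \<epsilon>\<in>{0<..}. g \<epsilon>) \<le> (SUP \<epsilon>\<in>{0<..}. h \<epsilon>)"
    by (intro SUP_mono) (use le in auto)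
  show "(SUP \<epsilon>\<in>{0<..}. h \<epsilon>) \<le> (SUP \<epsilon>\<in>{0<..}. g \<epsilon>)"
  proof (rule SUP_least, rule ereal_le_epsilon2)
    fix e \<eta> :: real assume "e \<in> {0<..}" and "\<eta> > 0"
    then obtain \<epsilon> where \<epsilon>: "\<epsilon> > 0" "\<And>e. 0 < e \<Longrightarrow> e \<le> \<epsilon> \<Longrightarrow> h (2 * e) \<le> g e + ereal \<eta>"
      using ge[OF \<open>\<eta> > 0\<close>] by blast
    define r where "r = min \<epsilon> (e / 2)"
    have r: "r > 0" "r \<le> \<epsilon>" "2 * r \<le> e" using \<epsilon> \<open>e \<in> _\<close> by (auto simp: r_def)
    have "h e \<le> h (2 * r)" using r by (intro mono) auto
    also have "\<dots> \<le> g r + ereal \<eta>" using r by (intro \<epsilon>) auto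
    also have "\<dots> \<le> (SUP \<epsilon>\<in>{0<..}. g \<epsilon>) + ereal \<eta>"
      using r by (intro add_right_mono SUP_upper) auto
    finally show "h e \<le> (SUP \<epsilon>\<in>{0<..}. g \<epsilon>) + ereal \<eta>" .
  qed
qed

lemma lower_span_eq_lower_sep:
  assumes "equicontinuous_seq X d f" "Z \<subseteq> X 0"
  shows "lower_span X d T f Z = lower_sep d T f Z"
proof -
  have "lower_span_at X d T f Z e \<le> lower_sep_at d T f Z e" if "e > 0" for e
    unfolding lower_span_at_def lower_sep_at_def
    by (intro Liminf_mono eventually_sequentiallyI[of 1] ereal_mult_left_mono elog_mono
        span_sum_le_sep_sum) (use that assms in auto)
  moreover have "\<exists>\<epsilon>>0. \<forall>e. 0 < e \<and> e \<le> \<epsilon> \<longrightarrow>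
      lower_sep_at d T f Z (2 * e) \<le> lower_span_at X d T f Z e + ereal \<eta>" if \<eta>: "\<eta> > 0" for \<eta>
  proof -
    obtain \<epsilon> where \<epsilon>: "\<epsilon> > 0" "\<And>e n. 0 < e \<Longrightarrow> e \<le> \<epsilon> \<Longrightarrow> n > 0 \<Longrightarrow>
      ereal (1 / real n) * elog (sep_sum d T f Z (2 * e) n)
      \<le> ereal (1 / real n) * elog (span_sum X d T f Z e n) + ereal \<eta>"
      using rate_le[OF assms \<eta>] by blast
    have "lower_sep_at d T f Z (2 * e) \<le> lower_span_at X d T f Z e + ereal \<eta>"
      if e: "0 < e" "e \<le> \<epsilon>" for e
    proof -
      have "lower_sep_at d T f Z (2 * e)
          \<le> liminf (\<lambda>n. ereal (1 / real n) * elog (span_sum X d T f Z e n) + ereal \<eta>)"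
        unfolding lower_sep_at_def
        by (intro Liminf_mono eventually_sequentiallyI[of 1] \<epsilon>) (use e in auto)
      also have "\<dots> = lower_span_at X d T f Z e + ereal \<eta>"
        unfolding lower_span_at_def by (rule Liminf_add_ereal_right) auto
      finally show ?thesis .
    qed
    then show ?thesis using \<epsilon>(1) by blast
  qed
  ultimately have "(SUP \<epsilon>\<in>{0<..}. lower_span_at X d T f Z \<epsilon>) = (SUP \<epsilon>\<in>{0<..}. lower_sep_at d T f Z \<epsilon>)"
    by (intro sup_eqI lower_sep_at_antimono)
  then show ?thesis
    unfolding lower_span_def lower_sep_def
    by (simp add: Lim_at_right_antimono lower_span_at_antimono lower_sep_at_antimono)
qed

lemma upper_span_eq_upper_sep:
  assumes "equicontinuous_seq X d f" "Z \<subseteq> X 0"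
  shows "upper_span X d T f Z = upper_sep d T f Z"
proof -
  have "upper_span_at X d T f Z e \<le> upper_sep_at d T f Z e" if "e > 0" for e
    unfolding upper_span_at_def upper_sep_at_def
    by (intro Limsup_mono eventually_sequentiallyI[of 1] ereal_mult_left_mono elog_mono
        span_sum_le_sep_sum) (use that assms in auto)
  moreover have "\<exists>\<epsilon>>0. \<forall>e. 0 < e \<and> e \<le> \<epsilon> \<longrightarrow>
      upper_sep_at d T f Z (2 * e) \<le> upper_span_at X d T f Z e + ereal \<eta>" if \<eta>: "\<eta> > 0" for \<eta>
  proof -
    obtain \<epsilon> where \<epsilon>: "\<epsilon> > 0" "\<And>e n. 0 < e \<Longrightarrow> e \<le> \<epsilon> \<Longrightarrow> n > 0 \<Longrightarrow>
      ereal (1 / real n) * elog (sep_sum d T f Z (2 * e) n)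
      \<le> ereal (1 / real n) * elog (span_sum X d T f Z e n) + ereal \<eta>"
      using rate_le[OF assms \<eta>] by blast
    have "upper_sep_at d T f Z (2 * e) \<le> upper_span_at X d T f Z e + ereal \<eta>"
      if e: "0 < e" "e \<le> \<epsilon>" for e
    proof -
      have "upper_sep_at d T f Z (2 * e)
          \<le> limsup (\<lambda>n. ereal (1 / real n) * elog (span_sum X d T f Z e n) + ereal \<eta>)"
        unfolding upper_sep_at_def
        by (intro Limsup_mono eventually_sequentiallyI[of 1] \<epsilon>) (use e in auto)
      also have "\<dots> = upper_span_at X d T f Z e + ereal \<eta>"
        unfolding upper_span_at_def by (rule Limsup_add_ereal_right) auto
      finally show ?thesis .
    qed
    then show ?thesis using \<epsilon>(1) by blast
  qed
  ultimately have "(SUP \<epsilon>\<in>{0<..}. upper_span_at X d T f Z \<epsilon>) = (SUP \<epsilon>\<in>{0<..}. upper_sep_at d T f Z \<epsilon>)"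
    by (intro sup_eqI upper_sep_at_antimono)
  then show ?thesis
    unfolding upper_span_def upper_sep_def
    by (simp add: Lim_at_right_antimono upper_span_at_antimono upper_sep_at_antimono)
qed

lemma lower_pressure_eq:
  assumes "equicontinuous_seq X d f" "Z \<subseteq> X 0"
  shows "lower_pressure X d T f Z = lower_span X d T f Z"
    and "lower_pressure X d T f Z = lower_sep d T f Z"
  using lower_span_eq_lower_sep[OF assms] by (auto simp: lower_pressure_def)

lemma upper_pressure_eq:
  assumes "equicontinuous_seq X d f" "Z \<subseteq> X 0"
  shows "upper_pressure X d T f Z = upper_span X d T f Z"
    and "upper_pressure X d T f Z = upper_sep d T f Z"
  using upper_span_eq_upper_sep[OF assms] by (auto simp: upper_pressure_def)

end

end

theory Submission
  imports Defs
begin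

text \<open>
  Uniform equivalence yields, for every \<open>\<epsilon> > 0\<close>, one \<open>\<delta> > 0\<close> with \<open>d k x y \<le> \<delta> \<Longrightarrow> d' k x y < \<epsilon>\<close>
  at all times \<open>k\<close> simultaneously. Hence \<open>d\<close>-Bowen balls of radius \<open>\<delta>\<close> lie in \<open>d'\<close>-Bowen balls of
  radius \<open>\<epsilon>\<close> at every order, and every pressure at scale \<open>\<epsilon>\<close> for \<open>d'\<close> is at most the one at scale
  \<open>\<delta>\<close> for \<open>d\<close>. Each pressure is the supremum over scales, so the claim follows by symmetry.
\<close>

context nds
begin

context
  fixes d' :: "nat \<Rightarrow> 'a \<Rightarrow> 'a \<Rightarrow> real" and \<delta> \<epsilon> :: real
  assumes close: "\<And>k x y. x \<in> X k \<Longrightarrow> y \<in> X k \<Longrightarrow> d k x y \<le> \<delta> \<Longrightarrow> d' k x y < \<epsilon>"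
begin

text \<open>The Bowen metric is a maximum over finitely many times, so the strict bounds at each
  time survive. For \<open>n = 0\<close> it is \<open>Max\<close> of the empty set, which is
  unspecified; hence \<open>n > 0\<close> here and the positive orders below.\<close>

lemma bowen_metric_close:
  assumes "n > 0" "x \<in> X 0" "y \<in> X 0" "bowen_metric d T n x y \<le> \<delta>"
  shows "bowen_metric d' T n x y < \<epsilon>"
proof -
  have "d' j (iter T j x) (iter T j y) < \<epsilon>" if "j < n" for j
    using assms that by (intro close iter_in) (auto simp: bowen_metric_le_iff)
  then show ?thesis
    using assms(1) unfolding bowen_metric_def by (subst Max_less_iff) auto
qed

text \<open>By contraposition of \<open>bowen_metric_close\<close>, sets \<epsilon>-separated for
  \<open>d'\<close> are \<delta>-separated for \<open>d\<close>. Birkhoff sums do not involve the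
  metric, so the supremum for \<open>d\<close> runs over more sets with the same weights.\<close>

lemma sep_sum_close:
  assumes "n > 0" "Z \<subseteq> X 0"
  shows "sep_sum d' T f Z \<epsilon> n \<le> sep_sum d T f Z \<delta> n"
proof -
  have "separated d T Z n \<delta> E" if E: "separated d' T Z n \<epsilon> E" for E
    unfolding separated_def
  proof (intro conjI ballI impI)
    show "E \<subseteq> Z" using E by (simp add: separated_def)
    fix x y assume xy: "x \<in> E" "y \<in> E" "x \<noteq> y"
    then have "x \<in> X 0" "y \<in> X 0" using \<open>E \<subseteq> Z\<close> assms by auto
    moreover have "bowen_metric d' T n x y > \<epsilon>" using E xy by (simp add: separated_def)
    ultimately show "bowen_metric d T n x y > \<delta>"
      using bowen_metric_close[OF assms(1), of x y] by linarith
  qed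
  then show ?thesis unfolding sep_sum_def by (intro SUP_subset_mono) auto
qed

lemma lower_sep_at_close:
  assumes "Z \<subseteq> X 0"
  shows "lower_sep_at d' T f Z \<epsilon> \<le> lower_sep_at d T f Z \<delta>"
  unfolding lower_sep_at_def
  by (intro Liminf_mono eventually_sequentiallyI[of 1] ereal_mult_left_mono elog_mono
      sep_sum_close assms) auto

lemma upper_sep_at_close:
  assumes "Z \<subseteq> X 0"
  shows "upper_sep_at d' T f Z \<epsilon> \<le> upper_sep_at d T f Z \<delta>"
  unfolding upper_sep_at_def
  by (intro Limsup_mono eventually_sequentiallyI[of 1] ereal_mult_left_mono elog_mono
      sep_sum_close assms) auto

text \<open>Keeping centres and orders, a cover by \<delta>-balls for \<open>d\<close> becomes a
  cover by \<epsilon>-balls for \<open>d'\<close> at the same cost.\<close>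

lemma bowen_outer_N_close:
  assumes "N > 0"
  shows "bowen_outer_N X d' T f Z \<epsilon> s N \<le> bowen_outer_N X d T f Z \<delta> s N"
proof -
  have ball: "bowen_ball X d T n x \<delta> \<subseteq> bowen_ball X d' T n x \<epsilon>" if "n \<ge> N" "x \<in> X 0" for n x
    using bowen_metric_close that assms by (auto simp: bowen_ball_def)
  have "bowen_cover X d' T Z \<epsilon> N I m x" if c: "bowen_cover X d T Z \<delta> N I m x" for I m x
  proof -
    have "(\<Union>i\<in>I. bowen_ball X d T (m i) (x i) \<delta>) \<subseteq> (\<Union>i\<in>I. bowen_ball X d' T (m i) (x i) \<epsilon>)"
      using c by (intro UN_mono ball) (auto simp: bowen_cover_def)
    then show ?thesis using c unfolding bowen_cover_def by blast
  qed
  then show ?thesis unfolding bowen_outer_N_def by (intro INF_superset_mono) auto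
qed

lemma bowen_pressure_at_close:
  "bowen_pressure_at X d' T f Z \<epsilon> \<le> bowen_pressure_at X d T f Z \<delta>"
proof -
  have "bowen_outer X d' T f Z \<epsilon> s \<le> bowen_outer X d T f Z \<delta> s" for s
    \<comment> \<open>Comparing the limits needs the inequality only from \<open>N = 1\<close> on,
      which excludes balls of order 0.\<close>
    by (rule LIMSEQ_le[OF bowen_outer_N_tendsto bowen_outer_N_tendsto])
       (intro exI[of _ 1] allI impI bowen_outer_N_close, simp)
  then have "bowen_outer X d T f Z \<delta> s = 0 \<Longrightarrow> bowen_outer X d' T f Z \<epsilon> s = 0" for s
    by (metis le_zero_eq)
  then show ?thesis
    unfolding bowen_pressure_at_def by (intro INF_superset_mono) auto
qed

text \<open>Shrinking balls preserves disjointness, so a packing for \<open>d'\<close> at scale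
  \<epsilon> is one for \<open>d\<close> at scale \<delta>.\<close>

lemma packing_pre_N_close:
  assumes "N > 0" "A \<subseteq> X 0"
  shows "packing_pre_N X d' T f A \<epsilon> s N \<le> packing_pre_N X d T f A \<delta> s N"
proof -
  have ball: "bowen_cball X d T n x \<delta> \<subseteq> bowen_cball X d' T n x \<epsilon>" if "n \<ge> N" "x \<in> X 0" for n x
    using bowen_metric_close that assms(1) by (auto simp: bowen_cball_def intro: less_imp_le)
  have "bowen_packing X d T A \<delta> N I m x" if p: "bowen_packing X d' T A \<epsilon> N I m x" for I m x
  proof -
    have "bowen_cball X d T (m i) (x i) \<delta> \<subseteq> bowen_cball X d' T (m i) (x i) \<epsilon>" if "i \<in> I" for i
      using p that assms(2) by (intro ball) (auto simp: bowen_packing_def)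
    then show ?thesis
      using p unfolding bowen_packing_def disjoint_family_on_def by blast
  qed
  then show ?thesis unfolding packing_pre_N_def by (intro SUP_subset_mono) auto
qed

lemma packing_pressure_at_close:
  "packing_pressure_at X d' T f Z \<epsilon> \<le> packing_pressure_at X d T f Z \<delta>"
proof -
  have "packing_pre X d' T f A \<epsilon> s \<le> packing_pre X d T f A \<delta> s" if "A \<subseteq> X 0" for A s
    by (rule LIMSEQ_le[OF packing_pre_N_tendsto packing_pre_N_tendsto])
       (intro exI[of _ 1] allI impI packing_pre_N_close that, simp)
  \<comment> \<open>Both infima run over the same decompositions; their pieces lie in
    \<open>X 0\<close> by definition, so the premeasures compare term by term.\<close>
  then have "packing_outer X d' T f Z \<epsilon> s \<le> packing_outer X d T f Z \<delta> s" for s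
    unfolding packing_outer_def by (intro INF_superset_mono suminf_le) auto
  then have "packing_outer X d T f Z \<delta> s = 0 \<Longrightarrow> packing_outer X d' T f Z \<epsilon> s = 0" for s
    by (metis le_zero_eq)
  then show ?thesis
    unfolding packing_pressure_at_def by (intro INF_superset_mono) auto
qed

end

end

text \<open>Both limits are suprema over positive scales, so it suffices to dominate each scale of
  \<open>h\<close> by some scale of \<open>g\<close>.\<close>

lemma Lim_at_right_antimono_le:
  fixes g h :: "real \<Rightarrow> ereal"
  assumes "\<And>a b. a \<le> b \<Longrightarrow> g b \<le> g a" "\<And>a b. a \<le> b \<Longrightarrow> h b \<le> h a"
    and "\<And>e. e > 0 \<Longrightarrow> \<exists>r>0. h e \<le> g r"
  shows "Lim (at_right 0) h \<le> Lim (at_right 0) g"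
proof -
  have "(SUP \<epsilon>\<in>{0<..}. h \<epsilon>) \<le> (SUP \<epsilon>\<in>{0<..}. g \<epsilon>)"
    using assms(3) by (intro SUP_mono) auto
  then show ?thesis using assms(1,2) by (simp add: Lim_at_right_antimono)
qed

lemma uniformly_equivalent_sym:
  "uniformly_equivalent X d d' \<longleftrightarrow> uniformly_equivalent X d' d"
  unfolding uniformly_equivalent_def by (simp add: conj_commute)

lemma uniformly_equivalent_close:
  assumes "uniformly_equivalent X d d'" "\<epsilon> > 0"
  obtains \<delta> where "\<delta> > 0" "\<And>k x y. x \<in> X k \<Longrightarrow> y \<in> X k \<Longrightarrow> d k x y \<le> \<delta> \<Longrightarrow> d' k x y < \<epsilon>"
proof -
  obtain r where r: "r > 0"
    "\<And>k x y. x \<in> X k \<Longrightarrow> y \<in> X k \<Longrightarrow> d k x y < r \<Longrightarrow> d' k x y < \<epsilon>"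
    using assms unfolding uniformly_equivalent_def by metis
  \<comment> \<open>Halving \<open>r\<close> turns the strict bound into the non-strict one that
    closed balls and separated sets require.\<close>
  show thesis by (rule that[of "r / 2"]) (use r in auto)
qed

text \<open>The moduli compose. This makes \<open>lower_pressure_eq\<close> and
  \<open>upper_pressure_eq\<close> available for \<open>d'\<close> too.\<close>

lemma equicontinuous_seq_transfer:
  assumes "uniformly_equivalent X d d'" "equicontinuous_seq X d f"
  shows "equicontinuous_seq X d' f"
  unfolding equicontinuous_seq_def
proof (intro allI impI)
  fix \<epsilon> :: real assume "\<epsilon> > 0"
  then obtain r where r: "r > 0"
    "\<And>k x y. x \<in> X k \<Longrightarrow> y \<in> X k \<Longrightarrow> d k x y < r \<Longrightarrow> \<bar>f k x - f k y\<bar> < \<epsilon>"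
    using assms(2) unfolding equicontinuous_seq_def by metis
  obtain \<delta> where "\<delta> > 0" "\<And>k x y. x \<in> X k \<Longrightarrow> y \<in> X k \<Longrightarrow> d' k x y \<le> \<delta> \<Longrightarrow> d k x y < r"
    using uniformly_equivalent_close[of X d' d r] assms(1) r(1) uniformly_equivalent_sym by blast
  then show "\<exists>\<delta>>0. \<forall>k. \<forall>x\<in>X k. \<forall>y\<in>X k. d' k x y < \<delta> \<longrightarrow> \<bar>f k x - f k y\<bar> < \<epsilon>"
    using r(2) by (intro exI[of _ \<delta>]) (auto simp: less_imp_le)
qed

text \<open>The separated versions stand in for the lower and upper pressures, which are
  \<open>THE\<close> terms and get identified with them in \<open>pressures_eq\<close>.\<close>

lemma (in nds) pressures_le:
  assumes ue: "uniformly_equivalent X d d'" and Z: "Z \<subseteq> X 0"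
  shows "bowen_pressure X d' T f Z \<le> bowen_pressure X d T f Z"
    and "packing_pressure X d' T f Z \<le> packing_pressure X d T f Z"
    and "lower_sep d' T f Z \<le> lower_sep d T f Z"
    and "upper_sep d' T f Z \<le> upper_sep d T f Z"
  unfolding bowen_pressure_def packing_pressure_def lower_sep_def upper_sep_def
  by (rule Lim_at_right_antimono_le;
      meson bowen_pressure_at_antimono packing_pressure_at_antimono
        lower_sep_at_antimono upper_sep_at_antimono uniformly_equivalent_close[OF ue]
        bowen_pressure_at_close packing_pressure_at_close
        lower_sep_at_close[OF _ Z] upper_sep_at_close[OF _ Z])+

lemma pressures_eq:
  assumes nds: "nds X d T" "nds X d' T" and ue: "uniformly_equivalent X d d'"
    and Z: "Z \<subseteq> X 0" and f: "equicontinuous_seq X d f"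
  shows "bowen_pressure X d T f Z = bowen_pressure X d' T f Z"
    and "packing_pressure X d T f Z = packing_pressure X d' T f Z"
    and "lower_pressure X d T f Z = lower_pressure X d' T f Z"
    and "upper_pressure X d T f Z = upper_pressure X d' T f Z"
proof -
  have ue': "uniformly_equivalent X d' d" using ue uniformly_equivalent_sym by blast
  note f' = equicontinuous_seq_transfer[OF ue f]
  note le = nds.pressures_le[OF nds(1) ue Z] nds.pressures_le[OF nds(2) ue' Z]
  show "bowen_pressure X d T f Z = bowen_pressure X d' T f Z"
    and "packing_pressure X d T f Z = packing_pressure X d' T f Z"
    by (rule antisym; rule le)+
  show "lower_pressure X d T f Z = lower_pressure X d' T f Z"
    unfolding nds.lower_pressure_eq(2)[OF nds(1) f Z] nds.lower_pressure_eq(2)[OF nds(2) f' Z]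
    by (rule antisym; rule le)
  show "upper_pressure X d T f Z = upper_pressure X d' T f Z"
    unfolding nds.upper_pressure_eq(2)[OF nds(1) f Z] nds.upper_pressure_eq(2)[OF nds(2) f' Z]
    by (rule antisym; rule le)
qed

theorem theorem7p4:
  fixes X :: "nat \<Rightarrow> 'a set" and d d' :: "nat \<Rightarrow> 'a \<Rightarrow> 'a \<Rightarrow> real"
    and T :: "nat \<Rightarrow> 'a \<Rightarrow> 'a" and Z :: "'a set"
  assumes "nds X d T"
    and "\<And>k. Metric_space (X k) (d' k)"
    and "\<And>k. Metric_space.mtopology (X k) (d k) = Metric_space.mtopology (X k) (d' k)"
    and "uniformly_equivalent X d d'"
    and "Z \<subseteq> X 0"
  shows "(\<forall>f. continuous_seq X d f \<and> equicontinuous_seq X d f \<longrightarrow>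
            bowen_pressure X d T f Z = bowen_pressure X d' T f Z \<and>
            packing_pressure X d T f Z = packing_pressure X d' T f Z \<and>
            lower_pressure X d T f Z = lower_pressure X d' T f Z \<and>
            upper_pressure X d T f Z = upper_pressure X d' T f Z) \<and>
         bowen_entropy X d T Z = bowen_entropy X d' T Z \<and>
         packing_entropy X d T Z = packing_entropy X d' T Z \<and>
         lower_entropy X d T Z = lower_entropy X d' T Z \<and>
         upper_entropy X d T Z = upper_entropy X d' T Z"
proof -
  \<comment> \<open>Compactness and continuity depend only on the topologies, which agree.\<close>
  have nds': "nds X d' T"
    using assms(1) unfolding nds_def by (simp add: assms(2) assms(3)[symmetric])
  \<comment> \<open>The entropies are the pressures of the zero sequence, for which any \<delta>
    works.\<close>
  have "equicontinuous_seq X d (\<lambda>_ _. 0)"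
    by (auto simp: equicontinuous_seq_def intro: exI[of _ 1])
  then show ?thesis
    unfolding bowen_entropy_def packing_entropy_def lower_entropy_def upper_entropy_def
    using pressures_eq[OF assms(1) nds' assms(4,5)] by blast
qed

end
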